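(* Let $\mathbb{F}$ be a field (finite or infinite) of characteristic different from $2$, let $n\geq 3$, and let $\circ$ be an involution of the first kind on the algebra $UT_n(\mathbb{F})$ of $n\times n$ upper triangular matrices over $\mathbb{F}$. Then \[C(UT_n(\mathbb{F}),\circ)=Id(UT_n(\mathbb{F}),\circ)+\mathbb{F}.\]
   Context: All algebras are unital and associative over $\mathbb{F}$. An involution of the first kind is an $\mathbb{F}$-linear anti-automorphism of order at most two. $Y=\{y_1,y_2,\ldots\}$ and $Z=\{z_1,z_2,\ldots\}$ are disjoint infinite sets and $\mathbb{F}\langle Y\cup Z\rangle$ is the free unital associative algebra on $Y\cup Z$ (with involution $y_i^*=y_i$, $z_i^*=-z_i$); $\mathbb{F}$ is identified with the constant polynomials. For an algebra with involution $(A,\circ)$, $A^+$ and $A^-$ are the sets of symmetric ($a^\circ=a$) and skew-symmetric ($a^\circ=-a$) elements and $Z(A)$ is the center of $A$. $Id(A,\circ)$ (the $*$-polynomial identities) is the set of $f(y_1,\ldots,y_m,z_1,\ldots,z_r)\in\mathbb{F}\langle Y\cup Z\rangle$ such that $f(a_1,\ldots,a_m,b_1,\ldots,b_r)=0$ for all $a_i\in A^+$, $b_j\in A^-$. $C(A,\circ)$ (the $*$-central polynomials) is the set of such $f$ with $f(a_1,\ldots,a_m,b_1,\ldots,b_r)\in Z(A)$ for all $a_i\in A^+$, $b_j\in A^-$. *)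

theory Defs
  imports
    "HOL-Library.Poly_Mapping"
    "HOL-Library.Set_Algebras"
    "HOL-Algebra.Module"
    "Jordan_Normal_Form.Matrix"
begin

section \<open>The free unital associative algebra on \<open>Y \<union> Z\<close>\<close>

datatype star_var = Y nat | Z nat

text \<open>Words form the free monoid, written additively, so that the convolution product
  of finitely supported functions is the multiplication of the free algebra.\<close>

datatype 'v word = Word (letters: "'v list")

instantiation word :: (type) monoid_add
begin

definition zero_word :: "'a word" where
  "0 = Word []"

definition plus_word :: "'a word \<Rightarrow> 'a word \<Rightarrow> 'a word" where
  "u + v = Word (letters u @ letters v)"

instance
  by standard (simp_all add: zero_word_def plus_word_def)

end

type_synonym 'a star_poly = "star_var word \<Rightarrow>\<^sub>0 'a"

definition const_polys :: "'a::field star_poly set" where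
  "const_polys = range (\<lambda>c. Poly_Mapping.single 0 c)"


section \<open>Algebras with involution\<close>

text \<open>An algebra over \<open>'a\<close> is given by a \<^typ>\<open>('a, 'b) module\<close> record, which carries a
  multiplication and a unit besides the module operations.\<close>

definition involution_first_kind :: "('a, 'b) module \<Rightarrow> ('b \<Rightarrow> 'b) \<Rightarrow> bool" where
  "involution_first_kind A s \<longleftrightarrow>
     (\<forall>x\<in>carrier A. s x \<in> carrier A) \<and>
     (\<forall>x\<in>carrier A. \<forall>y\<in>carrier A. s (x \<oplus>\<^bsub>A\<^esub> y) = s x \<oplus>\<^bsub>A\<^esub> s y) \<and>
     (\<forall>c. \<forall>x\<in>carrier A. s (c \<odot>\<^bsub>A\<^esub> x) = c \<odot>\<^bsub>A\<^esub> s x) \<and>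
     (\<forall>x\<in>carrier A. \<forall>y\<in>carrier A. s (x \<otimes>\<^bsub>A\<^esub> y) = s y \<otimes>\<^bsub>A\<^esub> s x) \<and>
     (\<forall>x\<in>carrier A. s (s x) = x)"

definition symmetric_elems :: "('a, 'b) module \<Rightarrow> ('b \<Rightarrow> 'b) \<Rightarrow> 'b set" where
  "symmetric_elems A s = {x \<in> carrier A. s x = x}"

definition skew_elems :: "('a, 'b) module \<Rightarrow> ('b \<Rightarrow> 'b) \<Rightarrow> 'b set" where
  "skew_elems A s = {x \<in> carrier A. s x = \<ominus>\<^bsub>A\<^esub> x}"

definition alg_center :: "('a, 'b) module \<Rightarrow> 'b set" where
  "alg_center A = {x \<in> carrier A. \<forall>y\<in>carrier A. x \<otimes>\<^bsub>A\<^esub> y = y \<otimes>\<^bsub>A\<^esub> x}"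

fun var_value :: "(nat \<Rightarrow> 'b) \<Rightarrow> (nat \<Rightarrow> 'b) \<Rightarrow> star_var \<Rightarrow> 'b" where
  "var_value a b (Y i) = a i"
| "var_value a b (Z i) = b i"

definition word_value :: "('a, 'b) module \<Rightarrow> (star_var \<Rightarrow> 'b) \<Rightarrow> star_var word \<Rightarrow> 'b" where
  "word_value A \<phi> w = foldr (\<lambda>v x. \<phi> v \<otimes>\<^bsub>A\<^esub> x) (letters w) \<one>\<^bsub>A\<^esub>"

text \<open>Values are assigned to all variables at once; the result depends only on those of the
  finitely many variables that occur in the polynomial.\<close>

definition poly_value ::
  "('a::field, 'b) module \<Rightarrow> (nat \<Rightarrow> 'b) \<Rightarrow> (nat \<Rightarrow> 'b) \<Rightarrow> 'a star_poly \<Rightarrow> 'b" where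
  "poly_value A a b f =
     (\<Oplus>\<^bsub>A\<^esub>w\<in>Poly_Mapping.keys f. Poly_Mapping.lookup f w \<odot>\<^bsub>A\<^esub> word_value A (var_value a b) w)"

definition star_identities :: "('a::field, 'b) module \<Rightarrow> ('b \<Rightarrow> 'b) \<Rightarrow> 'a star_poly set" where
  "star_identities A s =
     {f. \<forall>a b. (\<forall>i. a i \<in> symmetric_elems A s) \<and> (\<forall>j. b j \<in> skew_elems A s) \<longrightarrow>
        poly_value A a b f = \<zero>\<^bsub>A\<^esub>}"

definition star_central_polys :: "('a::field, 'b) module \<Rightarrow> ('b \<Rightarrow> 'b) \<Rightarrow> 'a star_poly set" where
  "star_central_polys A s =
     {f. \<forall>a b. (\<forall>i. a i \<in> symmetric_elems A s) \<and> (\<forall>j. b j \<in> skew_elems A s) \<longrightarrow>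
        poly_value A a b f \<in> alg_center A}"


section \<open>Upper triangular matrices\<close>

definition UT :: "nat \<Rightarrow> ('a::field, 'a mat) module" where
  "UT n = (module_mat TYPE('a) n n)
     \<lparr>carrier := {M \<in> carrier_mat n n. upper_triangular M}\<rparr>"

lemma upper_triangular_mult:
  fixes A B :: "'a::semiring_0 mat"
  assumes "A \<in> carrier_mat n n" "B \<in> carrier_mat n n" "upper_triangular A" "upper_triangular B"
  shows "upper_triangular (A * B)"
proof (unfold upper_triangular_def, intro allI impI)
  fix i j assume ij: "i < dim_row (A * B)" "j < i"
  have "A $$ (i,k) * B $$ (k,j) = 0" if "k < n" for k
    using assms ij that by (cases "k < i") (auto simp: upper_triangular_def)
  then show "(A * B) $$ (i,j) = 0"
    using assms ij by (auto simp: scalar_prod_def intro!: sum.neutral)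
qed

lemma upper_triangular_add:
  fixes A B :: "'a::monoid_add mat"
  assumes "A \<in> carrier_mat n n" "B \<in> carrier_mat n n" "upper_triangular A" "upper_triangular B"
  shows "upper_triangular (A + B)"
  using assms by (auto simp: upper_triangular_def)

text \<open>In particular the finite sums in \<^const>\<open>poly_value\<close> over \<^const>\<open>UT\<close> are genuine ones.\<close>

lemma ring_UT: "ring (UT n :: ('a::field, 'a mat) module)"
proof -
  have neg: "\<exists>y. y \<in> carrier_mat n n \<and> upper_triangular y \<and> y + x = 0\<^sub>m n n \<and> x + y = 0\<^sub>m n n"
    if "x \<in> carrier_mat n n" "upper_triangular x" for x :: "'a mat"
    using that by (intro exI[of _ "- x"]) (auto simp: upper_triangular_def)
  have ut: "upper_triangular (1\<^sub>m n :: 'a mat)" "upper_triangular (0\<^sub>m n n :: 'a mat)"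
    by (auto simp: upper_triangular_def)
  have simps:
    "carrier (UT n) = {M :: 'a mat. M \<in> carrier_mat n n \<and> upper_triangular M}"
    "mult (UT n) = ((*) :: 'a mat \<Rightarrow> _)" "one (UT n) = (1\<^sub>m n :: 'a mat)"
    "add (UT n) = ((+) :: 'a mat \<Rightarrow> _)" "zero (UT n) = (0\<^sub>m n n :: 'a mat)"
    by (auto simp: UT_def module_mat_def)
  show ?thesis
  proof (rule ringI)
    show "abelian_group (UT n :: ('a, 'a mat) module)"
    proof (rule abelian_groupI)
      fix x y assume "x \<in> carrier (UT n :: ('a, 'a mat) module)" "y \<in> carrier (UT n :: ('a, 'a mat) module)"
      then show "x \<oplus>\<^bsub>UT n\<^esub> y \<in> carrier (UT n)" "x \<oplus>\<^bsub>UT n\<^esub> y = y \<oplus>\<^bsub>UT n\<^esub> x"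
        using upper_triangular_add[of x n y] by (auto simp: simps comm_add_mat)
    next
      fix x assume "x \<in> carrier (UT n :: ('a, 'a mat) module)"
      then show "\<exists>y\<in>carrier (UT n). y \<oplus>\<^bsub>UT n\<^esub> x = \<zero>\<^bsub>UT n\<^esub>"
        using neg[of x] by (auto simp: simps)
    qed (use ut in \<open>auto simp: simps\<close>)
    show "monoid (UT n :: ('a, 'a mat) module)"
      by (rule monoidI) (use ut in \<open>auto simp: simps intro: upper_triangular_mult\<close>)
  qed (auto simp: simps add_mult_distrib_mat mult_add_distrib_mat)
qed

end

theory Submission
  imports Defs
begin

text \<open>A central value is a scalar matrix, hence determined by its top left entry, which depends
  only on the top left entries of the arguments. With \<open>e = e\<^sub>1\<^sub>1\<close>, every such family of top left
  entries is realised by the symmetric elements \<open>\<alpha>(e + e\<^sup>\<circ>)\<close> and the skew elements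
  \<open>\<beta>(e - e\<^sup>\<circ>)\<close>. As \<open>Ae = \<bbbF>e\<close> gives \<open>e\<^sup>\<circ>A = \<bbbF>e\<^sup>\<circ>\<close>, the diagonal of \<open>e\<^sup>\<circ>\<close> has at most one
  nonzero entry, and not in the first place. For \<open>n \<ge> 3\<close> these arguments therefore share a zero
  diagonal position, where the value is the constant term of the polynomial.\<close>

section \<open>Operations and entries in the algebra of upper triangular matrices\<close>

lemma UT_simps:
  "carrier (UT n) = {M :: 'a::field mat. M \<in> carrier_mat n n \<and> upper_triangular M}"
  "mult (UT n) = ((*) :: 'a mat \<Rightarrow> _)" "one (UT n) = (1\<^sub>m n :: 'a mat)"
  "add (UT n) = ((+) :: 'a mat \<Rightarrow> _)" "zero (UT n) = (0\<^sub>m n n :: 'a mat)"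
  "smult (UT n) = ((\<cdot>\<^sub>m) :: 'a \<Rightarrow> 'a mat \<Rightarrow> _)"
  by (auto simp: UT_def module_mat_def)

lemma UT_carrierD:
  assumes "M \<in> carrier (UT n)"
  shows "M \<in> carrier_mat n n" "upper_triangular M" "dim_row M = n" "dim_col M = n"
  using assms by (auto simp: UT_simps)

lemma UT_lower_zero:
  assumes "M \<in> carrier (UT n)" "i < n" "j < i"
  shows "M $$ (i, j) = 0"
  using UT_carrierD[OF assms(1)] assms(2,3) by (auto simp: upper_triangular_def)

lemma UT_smult_closed:
  assumes "M \<in> carrier (UT n)"
  shows "c \<cdot>\<^sub>m M \<in> carrier (UT n)"
  using assms by (auto simp: UT_simps upper_triangular_def)

lemma UT_add_closed:
  assumes "M \<in> carrier (UT n)" "N \<in> carrier (UT n)"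
  shows "M + N \<in> carrier (UT n)"
  using assms by (auto simp: UT_simps upper_triangular_def)

lemma UT_mult_closed:
  assumes "M \<in> carrier (UT n)" "N \<in> carrier (UT n)"
  shows "M * N \<in> carrier (UT n)"
  using assms by (auto simp: UT_simps intro: upper_triangular_mult)

lemma UT_one_closed: "(1\<^sub>m n :: 'a::field mat) \<in> carrier (UT n)"
  by (auto simp: UT_simps upper_triangular_def)

text \<open>Skewness is stated with the additive inverse of the record. Inverses in a ring are
  unique, so it is enough to exhibit one.\<close>

lemma UT_a_inv:
  fixes M :: "'a::field mat"
  assumes "M \<in> carrier (UT n)"
  shows "\<ominus>\<^bsub>UT n\<^esub> M = (-1) \<cdot>\<^sub>m M"
proof -
  interpret ring "UT n :: ('a, 'a mat) module" by (rule ring_UT)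
  have "(-1) \<cdot>\<^sub>m M \<oplus>\<^bsub>UT n\<^esub> M = \<zero>\<^bsub>UT n\<^esub>"
    using UT_carrierD[OF assms] by (auto simp: UT_simps)
  then show ?thesis
    using assms UT_smult_closed[OF assms] by (intro minus_equality)
qed

lemma UT_finsum_index:
  fixes g :: "'b \<Rightarrow> 'a::field mat"
  assumes "finite S" "\<And>w. w \<in> S \<Longrightarrow> g w \<in> carrier (UT n)" "i < n" "j < n"
  shows "(\<Oplus>\<^bsub>UT n\<^esub>w\<in>S. g w) $$ (i, j) = (\<Sum>w\<in>S. g w $$ (i, j))"
proof -
  interpret ring "UT n :: ('a, 'a mat) module" by (rule ring_UT)
  show ?thesis
    using assms
  proof (induction S rule: finite_induct)
    case empty
    then show ?case by (simp add: UT_simps)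
  next
    case (insert x S)
    have "finsum (UT n) g S \<in> carrier (UT n)"
      using insert.prems by (intro finsum_closed) auto
    then have "(g x \<oplus>\<^bsub>UT n\<^esub> finsum (UT n) g S) $$ (i, j)
        = g x $$ (i, j) + finsum (UT n) g S $$ (i, j)"
      using insert.prems by (auto simp: UT_simps)
    then show ?case
      using insert by (subst finsum_insert) auto
  qed
qed

text \<open>In the sum for the product entry, every term with k different from i has a factor below
  the diagonal. Hence each diagonal position gives a multiplicative functional, which drives all
  later evaluations.\<close>

lemma UT_mult_diag:
  assumes "M \<in> carrier (UT n)" "N \<in> carrier (UT n)" "i < n"
  shows "(M * N) $$ (i, i) = M $$ (i, i) * N $$ (i, i)"
proof -
  have "(M * N) $$ (i, i) = (\<Sum>k<n. M $$ (i, k) * N $$ (k, i))"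
    using UT_carrierD[OF assms(1)] UT_carrierD[OF assms(2)] assms(3)
    by (simp add: scalar_prod_def atLeast0LessThan)
  also have "\<dots> = (\<Sum>k<n. if k = i then M $$ (i, i) * N $$ (i, i) else 0)"
  proof (rule sum.cong)
    fix k assume "k \<in> {..<n}"
    then show "M $$ (i, k) * N $$ (k, i) = (if k = i then M $$ (i, i) * N $$ (i, i) else 0)"
      using UT_lower_zero[OF assms(1), of i k] UT_lower_zero[OF assms(2), of k i] assms(3)
      by (cases k i rule: linorder_cases) auto
  qed simp
  finally show ?thesis using assms(3) by simp
qed

section \<open>Values of words and polynomials\<close>

lemma word_value_closed:
  assumes "\<And>v. \<phi> v \<in> carrier (UT n)"
  shows "word_value (UT n) \<phi> w \<in> carrier (UT n)"
proof -
  have "foldr (\<lambda>v x. \<phi> v \<otimes>\<^bsub>UT n\<^esub> x) vs \<one>\<^bsub>UT n\<^esub> \<in> carrier (UT n)" for vs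
    using assms
    by (induction vs) (simp_all add: UT_simps(2,3) UT_mult_closed UT_one_closed)
  then show ?thesis by (simp add: word_value_def)
qed

lemma word_value_diag:
  assumes "\<And>v. \<phi> v \<in> carrier (UT n)" "i < n"
  shows "word_value (UT n) \<phi> w $$ (i, i) = prod_list (map (\<lambda>v. \<phi> v $$ (i, i)) (letters w))"
proof -
  have "foldr (\<lambda>v x. \<phi> v \<otimes>\<^bsub>UT n\<^esub> x) vs \<one>\<^bsub>UT n\<^esub> $$ (i, i) = prod_list (map (\<lambda>v. \<phi> v $$ (i, i)) vs)"
    for vs
  proof (induction vs)
    case (Cons v vs)
    have "word_value (UT n) \<phi> (Word vs) \<in> carrier (UT n)"
      using assms(1) by (rule word_value_closed)
    then show ?case
      using Cons UT_mult_diag[OF assms(1) _ assms(2)]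
      by (simp add: word_value_def UT_simps(2))
  qed (use assms in \<open>simp add: UT_simps\<close>)
  then show ?thesis by (simp add: word_value_def)
qed

lemma var_value_closed:
  assumes "\<And>i. a i \<in> carrier A" "\<And>j. b j \<in> carrier A"
  shows "var_value a b v \<in> carrier A"
  using assms by (cases v) auto

context
  fixes a b :: "nat \<Rightarrow> 'a::field mat" and n :: nat
  assumes closed: "\<And>i. a i \<in> carrier (UT n)" "\<And>j. b j \<in> carrier (UT n)"
begin

lemma poly_value_closed: "poly_value (UT n) a b f \<in> carrier (UT n)"
proof -
  interpret ring "UT n :: ('a, 'a mat) module" by (rule ring_UT)
  have "word_value (UT n) (var_value a b) w \<in> carrier (UT n)" for w
    by (rule word_value_closed) (rule var_value_closed, rule closed, rule closed)
  then show ?thesis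
    by (auto simp: poly_value_def UT_simps(6) intro!: finsum_closed UT_smult_closed)
qed

text \<open>The summation range \<open>S\<close> may exceed the support, since the extra
  coefficients vanish. This lets two polynomials be summed over one range, and lets the empty word
  be included even when its coefficient is zero.\<close>

lemma poly_value_index:
  assumes "i < n" "j < n" "finite S" "Poly_Mapping.keys f \<subseteq> S"
  shows "poly_value (UT n) a b f $$ (i, j) =
    (\<Sum>w\<in>S. Poly_Mapping.lookup f w * word_value (UT n) (var_value a b) w $$ (i, j))"
proof -
  have w: "word_value (UT n) (var_value a b) w \<in> carrier (UT n)" for w
    by (rule word_value_closed) (rule var_value_closed, rule closed, rule closed)
  have "poly_value (UT n) a b f $$ (i, j) = (\<Sum>w\<in>Poly_Mapping.keys f.
      (Poly_Mapping.lookup f w \<cdot>\<^sub>m word_value (UT n) (var_value a b) w) $$ (i, j))"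
    unfolding poly_value_def UT_simps(6)
    by (intro UT_finsum_index finite_keys UT_smult_closed w assms)
  also have "\<dots> = (\<Sum>w\<in>Poly_Mapping.keys f.
      Poly_Mapping.lookup f w * word_value (UT n) (var_value a b) w $$ (i, j))"
    using assms(1,2) UT_carrierD[OF w] by simp
  also have "\<dots> = (\<Sum>w\<in>S. Poly_Mapping.lookup f w * word_value (UT n) (var_value a b) w $$ (i, j))"
    using assms(3,4) by (intro sum.mono_neutral_left) (auto simp: in_keys_iff)
  finally show ?thesis .
qed

lemma poly_value_add:
  "poly_value (UT n) a b (f + g) = poly_value (UT n) a b f + poly_value (UT n) a b g"
proof (rule eq_matI)
  note dims = UT_carrierD[OF poly_value_closed]
  fix i j assume "i < dim_row (poly_value (UT n) a b f + poly_value (UT n) a b g)"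
    "j < dim_col (poly_value (UT n) a b f + poly_value (UT n) a b g)"
  then have ij: "i < n" "j < n" using dims by auto
  let ?S = "Poly_Mapping.keys f \<union> Poly_Mapping.keys g"
  have "poly_value (UT n) a b (f + g) $$ (i, j)
      = poly_value (UT n) a b f $$ (i, j) + poly_value (UT n) a b g $$ (i, j)"
    using ij Poly_Mapping.keys_add[of f g]
    by (simp add: poly_value_index[where S = ?S] lookup_add distrib_right sum.distrib)
  then show "poly_value (UT n) a b (f + g) $$ (i, j)
      = (poly_value (UT n) a b f + poly_value (UT n) a b g) $$ (i, j)"
    using ij dims by simp
qed (use UT_carrierD[OF poly_value_closed] in auto)

lemma poly_value_const:
  "poly_value (UT n) a b (Poly_Mapping.single 0 c) = c \<cdot>\<^sub>m 1\<^sub>m n"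
proof (rule eq_matI)
  fix i j assume "i < dim_row (c \<cdot>\<^sub>m 1\<^sub>m n)" "j < dim_col (c \<cdot>\<^sub>m 1\<^sub>m n)"
  then show "poly_value (UT n) a b (Poly_Mapping.single 0 c) $$ (i, j) = (c \<cdot>\<^sub>m 1\<^sub>m n) $$ (i, j)"
    by (subst poly_value_index[where S = "{0}"])
      (auto simp: word_value_def zero_word_def UT_simps)
qed (use UT_carrierD[OF poly_value_closed] in auto)

text \<open>A nonempty word contributes a product with a zero factor, and the empty word contributes
  the empty product 1. The word \<open>0\<close> is the empty one, so \<open>lookup f 0\<close> is
  the constant term.\<close>

lemma poly_value_diag_zero:
  assumes "i < n" "\<And>k. a k $$ (i, i) = 0" "\<And>k. b k $$ (i, i) = 0"
  shows "poly_value (UT n) a b f $$ (i, i) = Poly_Mapping.lookup f 0"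
proof -
  have zero: "var_value a b v $$ (i, i) = 0" for v
    using assms by (cases v) auto
  have "word_value (UT n) (var_value a b) w $$ (i, i) = (if w = 0 then 1 else 0)" for w
    using word_value_diag[of "var_value a b" n i w, OF var_value_closed[OF closed] assms(1)]
    by (cases w; cases "letters w") (auto simp: zero zero_word_def)
  \<comment> \<open>The empty word is inserted because it is missing from \<open>keys f\<close> when
    the constant term is zero.\<close>
  then have "poly_value (UT n) a b f $$ (i, i) =
      (\<Sum>w\<in>insert 0 (Poly_Mapping.keys f). Poly_Mapping.lookup f w * (if w = 0 then 1 else 0))"
    using assms(1) poly_value_index[of i i "insert 0 (Poly_Mapping.keys f)" f] by auto
  also have "\<dots> = (\<Sum>w\<in>insert 0 (Poly_Mapping.keys f). if w = 0 then Poly_Mapping.lookup f 0 else 0)"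
    by (rule sum.cong) simp_all
  also have "\<dots> = Poly_Mapping.lookup f 0"
    by (subst sum.delta) simp_all
  finally show ?thesis .
qed

end

text \<open>Taking a diagonal entry is an algebra homomorphism to the field, so it commutes with
  evaluation and sees only the matching entries of the arguments.\<close>

lemma poly_value_diag_cong:
  assumes "\<And>k. a k \<in> carrier (UT n)" "\<And>k. b k \<in> carrier (UT n)"
    and "\<And>k. a' k \<in> carrier (UT n)" "\<And>k. b' k \<in> carrier (UT n)"
    and "i < n" "\<And>k. a k $$ (i, i) = a' k $$ (i, i)" "\<And>k. b k $$ (i, i) = b' k $$ (i, i)"
  shows "poly_value (UT n) a b f $$ (i, i) = poly_value (UT n) a' b' f $$ (i, i)"
proof -
  have eq: "var_value a b v $$ (i, i) = var_value a' b' v $$ (i, i)" for v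
    using assms(6,7) by (cases v) auto
  show ?thesis
    using assms(5) poly_value_index[OF assms(1,2), of i i "Poly_Mapping.keys f" f]
      poly_value_index[OF assms(3,4), of i i "Poly_Mapping.keys f" f]
    by (simp add: eq word_value_diag[of "var_value a b", OF var_value_closed[OF assms(1,2)]]
        word_value_diag[of "var_value a' b'", OF var_value_closed[OF assms(3,4)]])
qed

section \<open>Matrix units and the center\<close>

definition unit_mat :: "nat \<Rightarrow> nat \<Rightarrow> nat \<Rightarrow> 'a::field mat" where
  "unit_mat n i j = mat n n (\<lambda>(k, l). if k = i \<and> l = j then 1 else 0)"

lemma unit_mat_index:
  "k < n \<Longrightarrow> l < n \<Longrightarrow> unit_mat n i j $$ (k, l) = (if k = i \<and> l = j then 1 else 0)"
  by (simp add: unit_mat_def)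

lemma unit_mat_closed: "i \<le> j \<Longrightarrow> unit_mat n i j \<in> carrier (UT n)"
  by (auto simp: UT_simps unit_mat_def upper_triangular_def)

lemma mult_unit_mat_index:
  assumes "M \<in> carrier_mat n n" "i < n" "j < n" "k < n" "l < n"
  shows "(M * unit_mat n i j) $$ (k, l) = (if l = j then M $$ (k, i) else 0)"
proof -
  have "(M * unit_mat n i j) $$ (k, l) = (\<Sum>x<n. M $$ (k, x) * (if x = i \<and> l = j then 1 else 0))"
    using assms by (simp add: scalar_prod_def atLeast0LessThan unit_mat_def)
  also have "\<dots> = (\<Sum>x<n. if x = i then if l = j then M $$ (k, i) else 0 else 0)"
    by (rule sum.cong) auto
  finally show ?thesis using assms by simp
qed

lemma unit_mat_mult_index:
  assumes "M \<in> carrier_mat n n" "i < n" "j < n" "k < n" "l < n"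
  shows "(unit_mat n i j * M) $$ (k, l) = (if k = i then M $$ (j, l) else 0)"
proof -
  have "(unit_mat n i j * M) $$ (k, l) = (\<Sum>x<n. (if k = i \<and> x = j then 1 else 0) * M $$ (x, l))"
    using assms by (simp add: scalar_prod_def atLeast0LessThan unit_mat_def)
  also have "\<dots> = (\<Sum>x<n. if x = j then if k = i then M $$ (j, l) else 0 else 0)"
    by (rule sum.cong) auto
  finally show ?thesis using assms by simp
qed

text \<open>Only upper triangular matrix units are available as test elements. Commuting with the
  diagonal ones kills the off-diagonal entries, and commuting with those in the first row equates
  the diagonal entries.\<close>

lemma UT_center_scalar:
  fixes M :: "'a::field mat"
  assumes "M \<in> alg_center (UT n)" "0 < n"
  shows "M = M $$ (0, 0) \<cdot>\<^sub>m 1\<^sub>m n"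
proof -
  have M: "M \<in> carrier (UT n)" and comm: "\<And>N. N \<in> carrier (UT n) \<Longrightarrow> M * N = N * M"
    using assms(1) by (auto simp: alg_center_def UT_simps(2))
  note M' = UT_carrierD[OF M]
  show ?thesis
  proof (rule eq_matI)
    fix i j assume "i < dim_row (M $$ (0, 0) \<cdot>\<^sub>m 1\<^sub>m n)" "j < dim_col (M $$ (0, 0) \<cdot>\<^sub>m 1\<^sub>m n)"
    then have ij: "i < n" "j < n" by auto
    have "M $$ (i, j) = 0" if "i \<noteq> j"
    proof -
      have "(M * unit_mat n j j) $$ (i, j) = (unit_mat n j j * M) $$ (i, j)"
        by (simp add: comm unit_mat_closed)
      then show ?thesis
        using ij that M'(1) by (simp add: mult_unit_mat_index unit_mat_mult_index)
    qed
    moreover have "M $$ (i, i) = M $$ (0, 0)"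
    proof -
      have "(M * unit_mat n 0 i) $$ (0, i) = (unit_mat n 0 i * M) $$ (0, i)"
        by (simp add: comm unit_mat_closed)
      then show ?thesis
        using ij M'(1) assms(2) by (simp add: mult_unit_mat_index unit_mat_mult_index)
    qed
    ultimately show "M $$ (i, j) = (M $$ (0, 0) \<cdot>\<^sub>m 1\<^sub>m n) $$ (i, j)"
      using ij by (cases "i = j") auto
  qed (use M' in auto)
qed

lemma scalar_in_UT_center: "c \<cdot>\<^sub>m 1\<^sub>m n \<in> alg_center (UT n)"
  using UT_smult_closed[OF UT_one_closed, of c n] UT_carrierD
  by (auto simp: alg_center_def UT_simps mult_smult_distrib)

section \<open>The image of the first diagonal matrix unit under the involution\<close>

lemma involution_unit_mat_diag:
  fixes s :: "'a::field mat \<Rightarrow> 'a mat"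
  assumes inv: "involution_first_kind (UT n) s" and n: "2 \<le> n"
  defines "e' \<equiv> s (unit_mat n 0 0)"
  shows "e' $$ (0, 0) = 0"
    and "\<And>i j. i < n \<Longrightarrow> j < n \<Longrightarrow> i \<noteq> j \<Longrightarrow> e' $$ (i, i) = 0 \<or> e' $$ (j, j) = 0"
proof -
  let ?e = "unit_mat n 0 0 :: 'a mat"
  have e: "?e \<in> carrier (UT n)" by (simp add: unit_mat_closed)
  have e': "e' \<in> carrier (UT n)"
    using inv e by (auto simp: involution_first_kind_def e'_def)
  note e'_mat = UT_carrierD[OF e']
  \<comment> \<open>Writing y as the image of \<open>x = s y\<close> turns the left ideal generated
    by \<open>?e\<close> into the right ideal generated by \<open>e'\<close>; the former is a
    line.\<close>
  have line: "\<exists>\<mu>. e' * y = \<mu> \<cdot>\<^sub>m e'" if y: "y \<in> carrier (UT n)" for y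
  proof -
    define x where "x = s y"
    have x: "x \<in> carrier (UT n)" "s x = y"
      using inv y by (auto simp: involution_first_kind_def x_def)
    \<comment> \<open>Right multiplication by \<open>?e\<close> keeps only the first column of x,
      and triangularity leaves just its top entry.\<close>
    have "x * ?e = x $$ (0, 0) \<cdot>\<^sub>m ?e"
    proof (rule eq_matI)
      fix k l assume "k < dim_row (x $$ (0, 0) \<cdot>\<^sub>m ?e)" "l < dim_col (x $$ (0, 0) \<cdot>\<^sub>m ?e)"
      then have "k < n" "l < n" by (auto simp: unit_mat_def)
      then show "(x * ?e) $$ (k, l) = (x $$ (0, 0) \<cdot>\<^sub>m ?e) $$ (k, l)"
        using UT_carrierD[OF x(1)] UT_lower_zero[OF x(1), of k 0] UT_carrierD[OF e]
        by (subst mult_unit_mat_index) (auto simp: unit_mat_index)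
    qed (use UT_carrierD[OF x(1)] in \<open>auto simp: unit_mat_def\<close>)
    moreover have "s (x * ?e) = e' * y"
      using inv x e by (auto simp: involution_first_kind_def e'_def UT_simps(2))
    moreover have "s (x $$ (0, 0) \<cdot>\<^sub>m ?e) = x $$ (0, 0) \<cdot>\<^sub>m e'"
      using inv e by (auto simp: involution_first_kind_def e'_def UT_simps(6))
    ultimately show ?thesis by metis
  qed
  \<comment> \<open>Multiplying by the i-th diagonal unit erases all columns but the i-th, yet only
    rescales \<open>e'\<close>. The nonzero (i, i) entry survives, so the factor is nonzero and the
    erased columns were already zero.\<close>
  have column: "e' $$ (k, l) = 0" if "i < n" "e' $$ (i, i) \<noteq> 0" "k < n" "l < n" "l \<noteq> i" for i k l
  proof -
    obtain \<mu> where \<mu>: "e' * unit_mat n i i = \<mu> \<cdot>\<^sub>m e'"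
      using line[of "unit_mat n i i"] by (auto simp: unit_mat_closed)
    have val: "(if q = i then e' $$ (p, i) else 0) = \<mu> * e' $$ (p, q)" if "p < n" "q < n" for p q
      using arg_cong[OF \<mu>, of "\<lambda>M. M $$ (p, q)"] \<open>i < n\<close> that e'_mat
      by (simp add: mult_unit_mat_index)
    have "\<mu> \<noteq> 0" using val[of i i] that by auto
    then show ?thesis using val[of k l] that by auto
  qed
  show "e' $$ (i, i) = 0 \<or> e' $$ (j, j) = 0" if "i < n" "j < n" "i \<noteq> j" for i j
    using column[of i j j] that by auto
  show "e' $$ (0, 0) = 0"
  proof (rule ccontr)
    assume nz: "e' $$ (0, 0) \<noteq> 0"
    \<comment> \<open>This unit moves column 0 of \<open>e'\<close> to column 1. The result is a
      multiple of \<open>e'\<close>, whose column 1 is zero by \<open>column\<close>, so the (0, 0)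
      entry would vanish.\<close>
    obtain \<mu> where \<mu>: "e' * unit_mat n 0 1 = \<mu> \<cdot>\<^sub>m e'"
      using line[of "unit_mat n 0 1"] by (auto simp: unit_mat_closed)
    have "e' $$ (0, 0) = \<mu> * e' $$ (0, 1)"
      using arg_cong[OF \<mu>, of "\<lambda>M. M $$ (0, 1)"] n e'_mat by (simp add: mult_unit_mat_index)
    also have "e' $$ (0, 1) = 0" using column[of 0 0 1] nz n by auto
    finally show False using nz by simp
  qed
qed

text \<open>The involution is linear and swaps \<open>e\<close> with \<open>s e\<close>, so it fixes
  their sum and negates their difference.\<close>

lemma involution_symmetric_skew_unit:
  fixes s :: "'a::field mat \<Rightarrow> 'a mat"
  assumes inv: "involution_first_kind (UT n) s"
  defines "e \<equiv> unit_mat n 0 0"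
  shows "c \<cdot>\<^sub>m (e + s e) \<in> symmetric_elems (UT n) s"
    and "c \<cdot>\<^sub>m (e + (-1) \<cdot>\<^sub>m s e) \<in> skew_elems (UT n) s"
proof -
  have e: "e \<in> carrier (UT n)" by (simp add: unit_mat_closed e_def)
  have add: "s (x + y) = s x + s y" if "x \<in> carrier (UT n)" "y \<in> carrier (UT n)" for x y
    using inv that by (auto simp: involution_first_kind_def UT_simps(4))
  have smult: "s (c \<cdot>\<^sub>m x) = c \<cdot>\<^sub>m s x" if "x \<in> carrier (UT n)" for c x
    using inv that by (auto simp: involution_first_kind_def UT_simps(6))
  have se: "s e \<in> carrier (UT n)" "s (s e) = e"
    using inv e by (auto simp: involution_first_kind_def)
  note mats = UT_carrierD[OF e] UT_carrierD[OF se(1)]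
  have sym: "e + s e \<in> carrier (UT n)" and skew: "e + (-1) \<cdot>\<^sub>m s e \<in> carrier (UT n)"
    using e se(1) by (auto intro: UT_add_closed UT_smult_closed)
  have "s (c \<cdot>\<^sub>m (e + s e)) = c \<cdot>\<^sub>m (s e + e)"
    using sym e se by (simp add: smult add)
  also have "s e + e = e + s e" using mats by (intro comm_add_mat) auto
  finally show "c \<cdot>\<^sub>m (e + s e) \<in> symmetric_elems (UT n) s"
    using UT_smult_closed[OF sym] by (auto simp: symmetric_elems_def)
  have "s (c \<cdot>\<^sub>m (e + (-1) \<cdot>\<^sub>m s e)) = c \<cdot>\<^sub>m (s e + (-1) \<cdot>\<^sub>m e)"
    using skew e se UT_smult_closed[OF se(1), of "-1"] by (simp add: smult add)
  also have "\<dots> = (-1) \<cdot>\<^sub>m (c \<cdot>\<^sub>m (e + (-1) \<cdot>\<^sub>m s e))"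
    using mats by (intro eq_matI) (auto simp: algebra_simps)
  finally show "c \<cdot>\<^sub>m (e + (-1) \<cdot>\<^sub>m s e) \<in> skew_elems (UT n) s"
    using UT_smult_closed[OF skew] by (simp add: skew_elems_def UT_a_inv)
qed

section \<open>Central polynomials take constant values\<close>

lemma central_value_const:
  fixes s :: "'a::field mat \<Rightarrow> 'a mat"
  assumes n: "n \<ge> 3" and inv: "involution_first_kind (UT n) s"
    and f: "f \<in> star_central_polys (UT n) s"
    and a: "\<And>i. a i \<in> symmetric_elems (UT n) s" and b: "\<And>j. b j \<in> skew_elems (UT n) s"
  shows "poly_value (UT n) a b f = Poly_Mapping.lookup f 0 \<cdot>\<^sub>m 1\<^sub>m n"
proof -
  define e where "e = (unit_mat n 0 0 :: 'a mat)"
  have e: "e \<in> carrier (UT n)" by (simp add: unit_mat_closed e_def)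
  then have se: "s e \<in> carrier (UT n)"
    using inv by (auto simp: involution_first_kind_def)
  note mats = UT_carrierD[OF e] UT_carrierD[OF se]
  have se0: "s e $$ (0, 0) = 0"
    using involution_unit_mat_diag(1)[OF inv] n by (simp add: e_def)
  \<comment> \<open>Positions 1 and 2 both exist because n is at least 3, and \<open>s e\<close> has
    a zero diagonal entry in at least one of them. Since k is positive, \<open>e\<close> vanishes
    there as well.\<close>
  obtain k where k: "0 < k" "k < n" "s e $$ (k, k) = 0"
    using involution_unit_mat_diag(2)[OF inv, of 1 2] n that[of 1] that[of 2] by (auto simp: e_def)
  \<comment> \<open>Both the sum and the difference of \<open>e\<close> and \<open>s e\<close> have
    top left entry 1, so these factors reproduce the top left entries of the original
    arguments.\<close>
  define a' where "a' = (\<lambda>i. a i $$ (0, 0) \<cdot>\<^sub>m (e + s e))"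
  define b' where "b' = (\<lambda>j. b j $$ (0, 0) \<cdot>\<^sub>m (e + (-1) \<cdot>\<^sub>m s e))"
  have a': "a' i \<in> symmetric_elems (UT n) s" and b': "b' i \<in> skew_elems (UT n) s" for i
    using involution_symmetric_skew_unit[OF inv] by (auto simp: a'_def b'_def e_def)
  have closed: "a i \<in> carrier (UT n)" "b i \<in> carrier (UT n)"
    "a' i \<in> carrier (UT n)" "b' i \<in> carrier (UT n)" for i
    using a[of i] b[of i] a'[of i] b'[of i] by (auto simp: symmetric_elems_def skew_elems_def)
  have top: "a' i $$ (0, 0) = a i $$ (0, 0)" "b' i $$ (0, 0) = b i $$ (0, 0)" for i
    using mats n se0 by (auto simp: a'_def b'_def e_def unit_mat_index)
  have zero: "a' i $$ (k, k) = 0" "b' i $$ (k, k) = 0" for i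
    using mats k by (auto simp: a'_def b'_def e_def unit_mat_index)
  have "poly_value (UT n) a b f \<in> alg_center (UT n)"
    and central': "poly_value (UT n) a' b' f \<in> alg_center (UT n)"
    using f a b a' b' by (auto simp: star_central_polys_def)
  moreover have "0 < n" using n by simp
  ultimately have scalar: "poly_value (UT n) a b f = poly_value (UT n) a b f $$ (0, 0) \<cdot>\<^sub>m 1\<^sub>m n"
    by (intro UT_center_scalar)
  note scalar' = UT_center_scalar[OF central' \<open>0 < n\<close>]
  \<comment> \<open>The new arguments are admissible, so the value there is scalar too: its entry
    can be carried from position 0 to position k, where all arguments vanish.\<close>
  have "poly_value (UT n) a b f $$ (0, 0) = poly_value (UT n) a' b' f $$ (0, 0)"
    using closed top n by (intro poly_value_diag_cong) auto
  also have "\<dots> = poly_value (UT n) a' b' f $$ (k, k)"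
    using arg_cong[OF scalar', of "\<lambda>M. M $$ (k, k)"] k(2) by simp
  also have "\<dots> = Poly_Mapping.lookup f 0"
    using closed(3,4) k(2) zero by (rule poly_value_diag_zero)
  finally have "poly_value (UT n) a b f $$ (0, 0) = Poly_Mapping.lookup f 0" .
  then show ?thesis by (subst scalar) (rule arg_cong)
qed

theorem theorem4p1:
  fixes n :: nat
    and s :: "'a::field mat \<Rightarrow> 'a mat"
  assumes "CHAR('a) \<noteq> 2"
    and "n \<ge> 3"
    and "involution_first_kind (UT n) s"
  shows "star_central_polys (UT n) s = star_identities (UT n) s + const_polys"
proof
  have closed: "M \<in> carrier (UT n)" if "M \<in> symmetric_elems (UT n) s \<or> M \<in> skew_elems (UT n) s" for M
    using that by (auto simp: symmetric_elems_def skew_elems_def)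
  show "star_central_polys (UT n) s \<subseteq> star_identities (UT n) s + const_polys"
  proof
    fix f assume f: "f \<in> star_central_polys (UT n) s"
    define c where "c = Poly_Mapping.lookup f 0"
    \<comment> \<open>Subtracting the constant term is written as adding a constant, so that
      additivity of evaluation applies.\<close>
    define g where "g = f + Poly_Mapping.single 0 (- c)"
    have "g \<in> star_identities (UT n) s"
      unfolding star_identities_def
    proof (intro CollectI allI impI, elim conjE)
      fix a b :: "nat \<Rightarrow> 'a mat"
      assume a: "\<forall>i. a i \<in> symmetric_elems (UT n) s" and b: "\<forall>j. b j \<in> skew_elems (UT n) s"
      have "poly_value (UT n) a b g = c \<cdot>\<^sub>m 1\<^sub>m n + (- c) \<cdot>\<^sub>m 1\<^sub>m n"
        using a b central_value_const[OF assms(2,3) f, of a b]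
        by (simp add: g_def c_def poly_value_add poly_value_const closed)
      then show "poly_value (UT n) a b g = \<zero>\<^bsub>UT n\<^esub>"
        by (auto simp: UT_simps)
    qed
    moreover have "f = g + Poly_Mapping.single 0 c"
      by (simp add: g_def add.assoc flip: single_add)
    ultimately show "f \<in> star_identities (UT n) s + const_polys"
      by (auto simp: const_polys_def intro: set_plus_intro)
  qed
  show "star_identities (UT n) s + const_polys \<subseteq> star_central_polys (UT n) s"
  proof
    fix f assume "f \<in> star_identities (UT n) s + const_polys"
    then obtain g c where g: "g \<in> star_identities (UT n) s" and f: "f = g + Poly_Mapping.single 0 c"
      by (auto simp: const_polys_def elim!: set_plus_elim)
    show "f \<in> star_central_polys (UT n) s"
      unfolding star_central_polys_def
    proof (intro CollectI allI impI, elim conjE)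
      fix a b :: "nat \<Rightarrow> 'a mat"
      assume a: "\<forall>i. a i \<in> symmetric_elems (UT n) s" and b: "\<forall>j. b j \<in> skew_elems (UT n) s"
      then have "poly_value (UT n) a b g = 0\<^sub>m n n"
        using g by (auto simp: star_identities_def UT_simps)
      \<comment> \<open>The identity contributes zero, leaving the scalar matrix of the
        constant.\<close>
      then have "poly_value (UT n) a b f = c \<cdot>\<^sub>m 1\<^sub>m n"
        using a b by (simp add: f poly_value_add poly_value_const closed)
      then show "poly_value (UT n) a b f \<in> alg_center (UT n)"
        by (simp add: scalar_in_UT_center)
    qed
  qed
qed

end
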